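(* Let $\mathcal H$ be a real Hilbert space, and let $T\colon\mathcal H\to\mathcal H$ and $U\colon\mathcal H\to\mathcal H$ be $\lambda$- and $\mu$-relaxed cutters, respectively, where $\lambda,\mu>0$. Assume that $\lambda\mu<4$ and $\operatorname{Fix}T\cap\operatorname{Fix}U\neq\emptyset$. Let $z\in\operatorname{Fix}T\cap\operatorname{Fix}U$, let $r>0$ and put $R:=\max\{r,(\lambda-1)r\}$. Let $UT$ denote the composition $x\mapsto U(T(x))$. The following statements hold: (i) If $T$ is weakly regular over $B(z,r)$ and $U$ is weakly regular over $B(z,R)$, then the operator $UT$ is weakly regular over $B(z,r)$. (ii) If $T$ is regular over $B(z,r)$, $U$ is regular over $B(z,R)$ and the pair $\{\operatorname{Fix}T,\operatorname{Fix}U\}$ is regular over $B(z,r)$, then the operator $UT$ is regular over $B(z,r)$. (iii) If $T$ is $\delta_1$-linearly regular over $B(z,r)$, $U$ is $\delta_2$-linearly regular over $B(z,R)$ and the pair $\{\operatorname{Fix}T,\operatorname{Fix}U\}$ is $\kappa$-linearly regular over $B(z,r)$, where $\delta_1,\delta_2\in(0,1]$ and $\kappa>0$, then the operator $UT$ is $\delta$-linearly regular over $B(z,r)$, where $$\delta:=\left(\frac{|\alpha|\min\{\delta_1,\delta_2\}}{2\kappa(1+\beta\sqrt{\nu})}\right)^2,\qquad \nu:=\frac{4(\lambda+\mu-\lambda\mu)}{4-\lambda\mu},$$ $$\alpha:=\sqrt{\tfrac1\lambda-\tfrac1\nu}-\sqrt{\tfrac1\mu-\tfrac1\nu}\neq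 0,\qquad \beta:=\max\left\{\sqrt{\tfrac1\lambda-\tfrac1\nu},\ \sqrt{\tfrac1\mu-\tfrac1\nu}\right\}>0.$$
   Context: $\operatorname{Fix}T:=\{x\in\mathcal H: T(x)=x\}$; $B(z,r)$ is the closed ball with center $z$ and radius $r$; $d(x,A):=\inf_{a\in A}\|x-a\|$; $\rightharpoonup$ denotes weak convergence. An operator $S\colon\mathcal H\to\mathcal H$ with $\operatorname{Fix}S\neq\emptyset$ is a cutter if $\langle z-S(x),x-S(x)\rangle\le 0$ for all $x\in\mathcal H$ and all $z\in\operatorname{Fix}S$. For $\lambda>0$, a $\lambda$-relaxed cutter is an operator of the form $\operatorname{Id}+\lambda(S-\operatorname{Id})$ with $S$ a cutter (it has the same fixed point set as $S$; this set is closed and convex). For $\lambda,\mu>0$ with $\lambda\mu<4$ one has $\nu\ge\max\{\lambda,\mu\}>0$, so the square roots are well defined. Regularity of operators. Let $S\subseteq\mathcal H$ be nonempty. An operator $T\colon\mathcal H\to\mathcal H$ is: - weakly regular over $S$ if for every sequence $\{x^k\}\subseteq S$: $x^k\rightharpoonup y$ and $\|T(x^k)-x^k\|\to0$ imply $y\in\operatorname{Fix}T$; - regular over $S$ if for every sequence $\{x^k\}\subseteq S$: $\|T(x^k)-x^k\|\to0$ implies $d(x^k,\operatorname{Fix}T)\to0$; - $\delta$-linearly regular over $S$, where $\delta>0$, if $\|T(x)-x\|\ge\delta\, d(x,\operatorname{Fix}T)$ for all $x\in S$. Regularity of sets. Let $A,B\subseteq\mathcal H$ be closed and convex with $A\cap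 B\ne\emptyset$ and $S\subseteq\mathcal H$ nonempty. The pair $\{A,B\}$ is: - regular over $S$ if for every sequence $\{x^k\}\subseteq S$: $\max\{d(x^k,A),d(x^k,B)\}\to0$ implies $d(x^k,A\cap B)\to0$; - $\kappa$-linearly regular over $S$, where $\kappa>0$, if $d(x,A\cap B)\le\kappa\max\{d(x,A),d(x,B)\}$ for all $x\in S$.
   Formalization: The claim α ≠ 0 fails when λ = μ (then α = 0 and δ = 0 is not admissible); α ≠ 0 is proved for λ ≠ μ, where (iii) holds with the stated δ, and for α = 0 statement (iii) gives δ-linear regularity of UT for some δ > 0 only. *)

theory Defs
  imports "HOL-Analysis.Analysis"
begin

definition Fix :: "('a \<Rightarrow> 'a) \<Rightarrow> 'a set" where
  "Fix T = {x. T x = x}"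

definition cutter :: "('a::real_inner \<Rightarrow> 'a) \<Rightarrow> bool" where
  "cutter S \<longleftrightarrow>
     Fix S \<noteq> {} \<and> (\<forall>x. \<forall>z\<in>Fix S. inner (z - S x) (x - S x) \<le> 0)"

definition relaxed_cutter :: "real \<Rightarrow> ('a::real_inner \<Rightarrow> 'a) \<Rightarrow> bool" where
  "relaxed_cutter l T \<longleftrightarrow>
     0 < l \<and> (\<exists>S. cutter S \<and> T = (\<lambda>x. x + l *\<^sub>R (S x - x)))"

text \<open>Weak convergence of sequences, tested against inner products; in a Hilbert space these are
  all the continuous linear functionals (Riesz).\<close>

definition weakly_converges :: "(nat \<Rightarrow> 'a::real_inner) \<Rightarrow> 'a \<Rightarrow> bool" where
  "weakly_converges x y \<longleftrightarrow> (\<forall>v. (\<lambda>k. inner (x k) v) \<longlonglongrightarrow> inner y v)"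

text \<open>The distance \<open>d(x, A)\<close> is rendered by \<^const>\<open>infdist\<close>, which is the infimum of the distances
  for nonempty \<open>A\<close> (and \<open>0\<close> for empty \<open>A\<close>). The set \<^term>\<open>Fix T\<close> is nonempty for every relaxed
  cutter \<open>T\<close>.\<close>

definition weakly_regular_op :: "('a::real_inner \<Rightarrow> 'a) \<Rightarrow> 'a set \<Rightarrow> bool" where
  "weakly_regular_op T S \<longleftrightarrow>
     (\<forall>x y. range x \<subseteq> S \<longrightarrow> weakly_converges x y \<longrightarrow>
        (\<lambda>k. norm (T (x k) - x k)) \<longlonglongrightarrow> 0 \<longrightarrow> y \<in> Fix T)"

definition regular_op :: "('a::real_inner \<Rightarrow> 'a) \<Rightarrow> 'a set \<Rightarrow> bool" where
  "regular_op T S \<longleftrightarrow>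
     (\<forall>x::nat \<Rightarrow> 'a. range x \<subseteq> S \<longrightarrow>
        (\<lambda>k. norm (T (x k) - x k)) \<longlonglongrightarrow> 0 \<longrightarrow>
        (\<lambda>k. infdist (x k) (Fix T)) \<longlonglongrightarrow> 0)"

definition linearly_regular_op :: "real \<Rightarrow> ('a::real_inner \<Rightarrow> 'a) \<Rightarrow> 'a set \<Rightarrow> bool" where
  "linearly_regular_op \<delta> T S \<longleftrightarrow>
     0 < \<delta> \<and> (\<forall>x\<in>S. norm (T x - x) \<ge> \<delta> * infdist x (Fix T))"

text \<open>Regularity of a pair of sets is intended for closed convex \<open>A\<close>, \<open>B\<close> with a common point; the
  fixed point sets of relaxed cutters are always closed and convex.\<close>

definition regular_sets :: "'a::real_inner set \<Rightarrow> 'a set \<Rightarrow> 'a set \<Rightarrow> bool" where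
  "regular_sets A B S \<longleftrightarrow>
     (\<forall>x::nat \<Rightarrow> 'a. range x \<subseteq> S \<longrightarrow>
        (\<lambda>k. max (infdist (x k) A) (infdist (x k) B)) \<longlonglongrightarrow> 0 \<longrightarrow>
        (\<lambda>k. infdist (x k) (A \<inter> B)) \<longlonglongrightarrow> 0)"

definition linearly_regular_sets ::
    "real \<Rightarrow> 'a::real_inner set \<Rightarrow> 'a set \<Rightarrow> 'a set \<Rightarrow> bool" where
  "linearly_regular_sets \<kappa> A B S \<longleftrightarrow>
     0 < \<kappa> \<and> (\<forall>x\<in>S. infdist x (A \<inter> B) \<le> \<kappa> * max (infdist x A) (infdist x B))"

end

theory Submission
  imports Defs
begin

text \<open>
  For \<open>a = T x - x\<close> and \<open>b = U (T x) - T x\<close> the cutter inequalities give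
  \<open>\<langle>z - x, a + b\<rangle> \<ge> \<parallel>a\<parallel>\<^sup>2 / \<lambda> + \<langle>a, b\<rangle> + \<parallel>b\<parallel>\<^sup>2 / \<mu>\<close> for every common fixed point \<open>z\<close>, and the right-hand
  side equals \<open>\<parallel>a + b\<parallel>\<^sup>2 / \<nu> + \<parallel>p a - q b\<parallel>\<^sup>2\<close> where
  \<open>p\<close>, \<open>q\<close> are the square roots of \<open>1/\<lambda> - 1/\<nu>\<close>, \<open>1/\<mu> - 1/\<nu>\<close> carrying the signs of
  \<open>2 - \<lambda>\<close>, \<open>2 - \<mu>\<close>. Since \<open>p + q > 0\<close>, both \<open>a\<close> and \<open>b\<close> are linear combinations of \<open>a + b\<close> and
  \<open>p a - q b\<close>. Hence a small displacement of \<open>U \<circ> T\<close> forces small displacements of \<open>T\<close> at \<open>x\<close> and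
  of \<open>U\<close> at \<open>T x\<close>, quantitatively in terms of the distance to the common fixed points. Moreover
  \<open>\<bar>\<alpha>\<bar> = \<bar>\<bar>p\<bar> - \<bar>q\<bar>\<bar> \<le> p + q\<close>, so the constant obtained with \<open>p + q\<close> in place of \<open>\<bar>\<alpha>\<bar>\<close> is
  at least as good, and it also covers \<open>\<alpha> = 0\<close>.
\<close>

section \<open>Distances to sets, monotonicity of constants, weak limits\<close>

lemma le_mult_infdist:
  assumes "A \<noteq> {}" and "0 \<le> k" and le: "\<And>a. a \<in> A \<Longrightarrow> m \<le> k * dist x a"
  shows "m \<le> k * infdist x A"
proof (cases "k = 0")
  case True
  with assms show ?thesis by auto
next
  case False
  with \<open>0 \<le> k\<close> have "0 < k" by simp
  have "m / k \<le> infdist x A"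
    unfolding infdist_notempty[OF \<open>A \<noteq> {}\<close>]
    using le \<open>0 < k\<close> by (intro cINF_greatest[OF \<open>A \<noteq> {}\<close>]) (simp add: field_simps)
  with \<open>0 < k\<close> show ?thesis by (simp add: field_simps)
qed

lemma linearly_regular_op_mono:
  assumes "linearly_regular_op \<delta> T S" and "0 < \<epsilon>" and "\<epsilon> \<le> \<delta>"
  shows "linearly_regular_op \<epsilon> T S"
  using assms unfolding linearly_regular_op_def
  by (meson infdist_nonneg mult_right_mono order_trans)

text \<open>Norm-null sequences are weakly null. With \<open>u k = T (x k) - x k\<close> this
  carries the weak limit of \<open>x k\<close> over to \<open>T (x k)\<close>.\<close>

lemma weakly_converges_add_null:
  assumes "weakly_converges x y" and "(\<lambda>k. norm (u k)) \<longlonglongrightarrow> 0"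
  shows "weakly_converges (\<lambda>k. x k + u k) y"
  unfolding weakly_converges_def
proof
  fix v
  have "(\<lambda>k. inner (u k) v) \<longlonglongrightarrow> inner 0 v"
    using tendsto_norm_zero_cancel[OF assms(2)] by (intro tendsto_intros)
  with assms(1) show "(\<lambda>k. inner (x k + u k) v) \<longlonglongrightarrow> inner y v"
    unfolding weakly_converges_def inner_add_left
    using tendsto_add[of "\<lambda>k. inner (x k) v" "inner y v" sequentially "\<lambda>k. inner (u k) v" 0] by simp
qed

section \<open>Inequalities for a single relaxed cutter\<close>

lemma relaxed_cutter_inner_ge:
  assumes "relaxed_cutter l T" and "z \<in> Fix T"
  shows "(norm (T x - x))\<^sup>2 / l \<le> inner (z - x) (T x - x)"
proof -
  obtain S where "0 < l" and S: "cutter S" and T: "T = (\<lambda>x. x + l *\<^sub>R (S x - x))"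
    using assms(1) by (auto simp: relaxed_cutter_def)
  have "z \<in> Fix S"
    using assms(2) \<open>0 < l\<close> by (simp add: Fix_def T)
  with S have "inner (z - S x) (x - S x) \<le> 0"
    by (auto simp: cutter_def)
  \<comment> \<open>Write \<open>z - S x = (z - x) - (S x - x)\<close>. Since
    \<open>T x - x = l *\<^sub>R (S x - x)\<close>, multiplying by \<open>l\<close> then gives the
    claim.\<close>
  then have "(norm (S x - x))\<^sup>2 \<le> inner (z - x) (S x - x)"
    by (simp add: power2_norm_eq_inner algebra_simps inner_commute)
  then have "l * (norm (S x - x))\<^sup>2 \<le> l * inner (z - x) (S x - x)"
    using \<open>0 < l\<close> by simp
  with \<open>0 < l\<close> show ?thesis
    by (simp add: T power_mult_distrib power2_eq_square)
qed

text \<open>The sign of \<open>1 - 2 / l\<close> decides: for \<open>l \<le> 2\<close> the operator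
  does not move away from \<open>z\<close>, while for \<open>l > 2\<close> it may overshoot, by at
  most the factor \<open>l - 1\<close>. This is the source of the radius \<open>R\<close>.\<close>

lemma relaxed_cutter_dist_le:
  assumes "relaxed_cutter l T" and "z \<in> Fix T"
  shows "norm (T x - z) \<le> max 1 (l - 1) * norm (x - z)"
proof -
  define n where "n = norm (T x - x)"
  define e where "e = norm (x - z)"
  have "0 < l" using assms(1) by (simp add: relaxed_cutter_def)
  have ip: "n\<^sup>2 / l \<le> inner (z - x) (T x - x)"
    unfolding n_def by (rule relaxed_cutter_inner_ge[OF assms])
  have "(norm (T x - z))\<^sup>2 = e\<^sup>2 - 2 * inner (z - x) (T x - x) + n\<^sup>2"
    unfolding e_def n_def power2_norm_eq_inner by (simp add: algebra_simps inner_commute)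
  with ip have *: "(norm (T x - z))\<^sup>2 \<le> e\<^sup>2 + (1 - 2 / l) * n\<^sup>2"
    by (simp add: algebra_simps)
  have "(norm (T x - z))\<^sup>2 \<le> (max 1 (l - 1) * e)\<^sup>2"
  proof (cases "l \<le> 2")
    case True
    then have "(1 - 2 / l) * n\<^sup>2 \<le> 0"
      using \<open>0 < l\<close> by (intro mult_nonpos_nonneg) (auto simp: field_simps)
    with * True show ?thesis by (simp add: max_def)
  next
    case False
    have "n\<^sup>2 / l \<le> e * n"
      using ip norm_cauchy_schwarz[of "z - x" "T x - x"]
      by (simp add: e_def n_def norm_minus_commute)
    then have "n \<le> l * e"
      using \<open>0 < l\<close> by (cases "n = 0") (auto simp: e_def n_def power2_eq_square field_simps)
    then have "n\<^sup>2 \<le> (l * e)\<^sup>2" by (simp add: n_def power_mono)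
    then have "(1 - 2 / l) * n\<^sup>2 \<le> (1 - 2 / l) * (l * e)\<^sup>2"
      using False by (intro mult_left_mono) (auto simp: field_simps)
    \<comment> \<open>Because \<open>(1 - 2 / l) * l\<^sup>2 = (l - 1)\<^sup>2 - 1\<close>.\<close>
    also have "\<dots> = ((l - 1) * e)\<^sup>2 - e\<^sup>2"
      using \<open>0 < l\<close> by (simp add: power2_eq_square field_simps)
    finally show ?thesis using * False by (simp add: max_def)
  qed
  then show ?thesis
    unfolding e_def by (rule power2_le_imp_le) simp
qed

section \<open>Displacement estimates for the composition, with signed roots \<open>p\<close> and
  \<open>q\<close>\<close>

locale relaxed_cutter_pair =
  fixes T U :: "'a::real_inner \<Rightarrow> 'a" and lam mu \<nu> p q :: real and z :: 'a and r :: real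
  assumes T: "relaxed_cutter lam T" and U: "relaxed_cutter mu U"
    and \<nu>_pos: "0 < \<nu>"
    and p_sq: "p\<^sup>2 = 1 / lam - 1 / \<nu>" and q_sq: "q\<^sup>2 = 1 / mu - 1 / \<nu>"
    and pq: "2 * p * q = 2 / \<nu> - 1" and pq_pos: "0 < p + q"
    and z: "z \<in> Fix T \<inter> Fix U" and r_pos: "0 < r"
begin

abbreviation "F \<equiv> Fix T \<inter> Fix U"

text \<open>The moduli recover the nonnegative roots of \<open>1 / lam - 1 / \<nu>\<close> and
  \<open>1 / mu - 1 / \<nu>\<close>, so the signs of \<open>p\<close> and \<open>q\<close> do not
  affect this constant.\<close>

definition "\<beta> = max \<bar>p\<bar> \<bar>q\<bar>"

lemma \<beta>_nonneg: "0 \<le> \<beta>"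
  by (simp add: \<beta>_def)

lemma K_pos: "0 < 1 + \<beta> * sqrt \<nu>"
  using \<beta>_nonneg \<nu>_pos by (simp add: add_pos_nonneg)

lemma composition_inner_ge:
  assumes y: "y \<in> F"
  shows "(norm (U (T x) - x))\<^sup>2 / \<nu> + (norm (p *\<^sub>R (T x - x) - q *\<^sub>R (U (T x) - T x)))\<^sup>2
    \<le> inner (y - x) (U (T x) - x)"
proof -
  define a where "a = T x - x"
  define b where "b = U (T x) - T x"
  have w: "U (T x) - x = a + b" by (simp add: a_def b_def)
  \<comment> \<open>The inequality for \<open>U\<close> is based at \<open>T x\<close>; moving it
    back to \<open>x\<close> creates the mixed term \<open>inner a b\<close>.\<close>
  have yT: "y - T x = (y - x) - a" by (simp add: a_def)
  have "inner a a / lam \<le> inner (y - x) a"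
    using relaxed_cutter_inner_ge[OF T, of y x] y by (simp add: a_def power2_norm_eq_inner)
  moreover have "inner b b / mu \<le> inner (y - x) b - inner a b"
    using relaxed_cutter_inner_ge[OF U, of y "T x"] y
    unfolding yT b_def[symmetric] by (simp add: power2_norm_eq_inner inner_diff_left)
  \<comment> \<open>By \<open>p_sq\<close>, \<open>q_sq\<close> and \<open>pq\<close> the three
    coefficients are \<open>1 / lam\<close>, \<open>1\<close> and \<open>1 / mu\<close>.\<close>
  moreover have "(norm (a + b))\<^sup>2 / \<nu> + (norm (p *\<^sub>R a - q *\<^sub>R b))\<^sup>2
      = (1 / \<nu> + p\<^sup>2) * inner a a + (2 / \<nu> - 2 * p * q) * inner a b + (1 / \<nu> + q\<^sup>2) * inner b b"
    unfolding power2_norm_eq_inner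
    by (simp add: inner_commute inner_add inner_diff power2_eq_square algebra_simps add_divide_distrib)
  ultimately show ?thesis
    unfolding w a_def[symmetric] b_def[symmetric] p_sq q_sq pq by (simp add: inner_add_right)
qed

text \<open>With \<open>s\<close> the square root on the right, dropping one or the other square in
  \<open>composition_inner_ge\<close> leaves \<open>norm c \<le> s\<close> or
  \<open>norm w \<le> sqrt \<nu> * s\<close>. Solving for the two displacements multiplies
  \<open>w\<close> by \<open>p\<close> or \<open>q\<close>, whence \<open>K\<close>.\<close>

lemma displacement_bounds:
  defines "K \<equiv> 1 + \<beta> * sqrt \<nu>"
  shows "(p + q) * norm (T x - x) \<le> K * sqrt (infdist x F * norm (U (T x) - x))"
    and "(p + q) * norm (U (T x) - T x) \<le> K * sqrt (infdist x F * norm (U (T x) - x))"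
proof -
  define a where "a = T x - x"
  define b where "b = U (T x) - T x"
  define w where "w = U (T x) - x"
  define c where "c = p *\<^sub>R a - q *\<^sub>R b"
  define s where "s = sqrt (infdist x F * norm w)"
  have F: "F \<noteq> {}" using z by blast
  \<comment> \<open>The left side does not depend on the common fixed point, so the infimum may be
    taken without a nearest point.\<close>
  have ge: "(norm w)\<^sup>2 / \<nu> + (norm c)\<^sup>2 \<le> norm w * infdist x F"
  proof (rule le_mult_infdist[OF F])
    fix y assume "y \<in> F"
    then show "(norm w)\<^sup>2 / \<nu> + (norm c)\<^sup>2 \<le> norm w * dist x y"
      using composition_inner_ge[of y x] norm_cauchy_schwarz[of "y - x" w]
      by (simp add: w_def c_def a_def b_def dist_norm norm_minus_commute mult.commute)
  qed simp
  have "(norm c)\<^sup>2 \<le> infdist x F * norm w"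
    using ge \<nu>_pos by (smt (verit) divide_nonneg_pos mult.commute zero_le_power2)
  then have c: "norm c \<le> s"
    unfolding s_def by (rule real_le_rsqrt)
  have "(norm w)\<^sup>2 \<le> \<nu> * (infdist x F * norm w)"
  proof -
    have "(norm w)\<^sup>2 / \<nu> \<le> infdist x F * norm w"
      using ge by (smt (verit) mult.commute zero_le_power2)
    with \<nu>_pos show ?thesis by (simp add: field_simps)
  qed
  then have w: "norm w \<le> sqrt \<nu> * s"
    unfolding s_def real_sqrt_mult[symmetric] by (rule real_le_rsqrt)
  have scaled: "norm (t *\<^sub>R w) \<le> \<beta> * (sqrt \<nu> * s)" if "\<bar>t\<bar> \<le> \<beta>" for t
    using that w \<beta>_nonneg by (simp add: mult_mono)
  have ab: "w = a + b" by (simp add: w_def a_def b_def)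
  have "(p + q) *\<^sub>R a = c + q *\<^sub>R w" and "(p + q) *\<^sub>R b = p *\<^sub>R w - c"
    by (simp_all add: ab c_def algebra_simps)
  then have "norm ((p + q) *\<^sub>R a) = norm (c + q *\<^sub>R w)"
    and "norm ((p + q) *\<^sub>R b) = norm (p *\<^sub>R w - c)"
    by (simp_all only:)
  moreover have "norm (c + q *\<^sub>R w) \<le> s + \<beta> * (sqrt \<nu> * s)"
    by (rule norm_triangle_le) (intro add_mono c scaled, simp add: \<beta>_def)
  moreover have "norm (p *\<^sub>R w - c) \<le> s + \<beta> * (sqrt \<nu> * s)"
    unfolding norm_minus_commute[of _ c]
    by (rule norm_triangle_le_diff) (intro add_mono c scaled, simp add: \<beta>_def)
  moreover have "K * s = s + \<beta> * (sqrt \<nu> * s)" by (simp add: K_def algebra_simps)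
  ultimately have "norm ((p + q) *\<^sub>R a) \<le> K * s" "norm ((p + q) *\<^sub>R b) \<le> K * s"
    by (simp_all only:)
  then show "(p + q) * norm (T x - x) \<le> K * sqrt (infdist x F * norm (U (T x) - x))"
    and "(p + q) * norm (U (T x) - T x) \<le> K * sqrt (infdist x F * norm (U (T x) - x))"
    using pq_pos by (simp_all add: a_def b_def s_def w_def)
qed

text \<open>At a fixed point of the composition the right side of \<open>displacement_bounds\<close>
  vanishes, so \<open>T\<close> does not move the point, and hence neither does
  \<open>U\<close>.\<close>

lemma Fix_comp: "Fix (U \<circ> T) = F"
proof
  show "Fix (U \<circ> T) \<subseteq> F"
  proof
    fix x assume "x \<in> Fix (U \<circ> T)"
    then have x: "U (T x) = x" by (simp add: Fix_def)
    then have "(p + q) * norm (T x - x) \<le> 0"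
      using displacement_bounds(1)[of x] by simp
    then have "T x = x"
      using pq_pos by (auto simp: mult_le_0_iff)
    with x show "x \<in> F" by (simp add: Fix_def)
  qed
qed (auto simp: Fix_def)

lemma T_in_cball:
  assumes "x \<in> cball z r"
  shows "T x \<in> cball z (max r ((lam - 1) * r))"
proof -
  have "norm (T x - z) \<le> max 1 (lam - 1) * norm (x - z)"
    using relaxed_cutter_dist_le[OF T] z by blast
  also have "\<dots> \<le> max 1 (lam - 1) * r"
    using assms by (intro mult_left_mono) (auto simp: dist_norm norm_minus_commute)
  also have "\<dots> = max r ((lam - 1) * r)"
    using r_pos by (simp add: max_mult_distrib_right)
  finally show ?thesis by (simp add: dist_norm norm_minus_commute)
qed

text \<open>On the ball the distance to \<open>F\<close> is at most \<open>r\<close>, since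
  \<open>z\<close> lies in \<open>F\<close>. Both displacements are then dominated by a constant
  times the root of the displacement of the composition.\<close>

lemma displacements_tendsto_0:
  assumes x: "range x \<subseteq> cball z r" and lim: "(\<lambda>k. norm (U (T (x k)) - x k)) \<longlonglongrightarrow> 0"
  shows "(\<lambda>k. norm (T (x k) - x k)) \<longlonglongrightarrow> 0" and "(\<lambda>k. norm (U (T (x k)) - T (x k))) \<longlonglongrightarrow> 0"
proof -
  define h where
    "h k = (1 + \<beta> * sqrt \<nu>) * sqrt (r * norm (U (T (x k)) - x k)) / (p + q)" for k
  have "h \<longlonglongrightarrow> (1 + \<beta> * sqrt \<nu>) * sqrt (r * 0) / (p + q)"
    unfolding h_def using pq_pos by (intro tendsto_intros lim) simp
  then have h: "h \<longlonglongrightarrow> 0" by simp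
  have d: "infdist (x k) F \<le> r" for k
  proof -
    have "dist (x k) z \<le> r" using subsetD[OF x rangeI[of x k]] by (simp add: dist_commute)
    then show ?thesis using infdist_le2[OF z] by blast
  qed
  have "sqrt (infdist (x k) F * norm (U (T (x k)) - x k)) \<le> sqrt (r * norm (U (T (x k)) - x k))" for k
    using d by (simp add: mult_right_mono)
  then have K: "(1 + \<beta> * sqrt \<nu>) * sqrt (infdist (x k) F * norm (U (T (x k)) - x k))
      \<le> (p + q) * h k" for k
    using K_pos pq_pos by (simp add: h_def mult_left_mono)
  have "norm (T (x k) - x k) \<le> h k" and "norm (U (T (x k)) - T (x k)) \<le> h k" for k
    using order_trans[OF displacement_bounds(1) K[of k]]
      order_trans[OF displacement_bounds(2) K[of k]] pq_pos by simp_all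
  then show "(\<lambda>k. norm (T (x k) - x k)) \<longlonglongrightarrow> 0" and "(\<lambda>k. norm (U (T (x k)) - T (x k))) \<longlonglongrightarrow> 0"
    by (auto intro!: tendsto_sandwich[OF _ _ tendsto_const h])
qed

section \<open>Transfer of the three kinds of regularity to the composition\<close>

lemma weakly_regular_comp:
  assumes "weakly_regular_op T (cball z r)"
    and "weakly_regular_op U (cball z (max r ((lam - 1) * r)))"
  shows "weakly_regular_op (U \<circ> T) (cball z r)"
  unfolding weakly_regular_op_def Fix_comp
proof (intro allI impI)
  fix x y
  assume x: "range x \<subseteq> cball z r" and y: "weakly_converges x y"
    and "(\<lambda>k. norm ((U \<circ> T) (x k) - x k)) \<longlonglongrightarrow> 0"
  then have a: "(\<lambda>k. norm (T (x k) - x k)) \<longlonglongrightarrow> 0"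
    and b: "(\<lambda>k. norm (U (T (x k)) - T (x k))) \<longlonglongrightarrow> 0"
    using displacements_tendsto_0[OF x] by simp_all
  have "y \<in> Fix T"
    using assms(1) x y a unfolding weakly_regular_op_def by blast
  moreover have "weakly_converges (\<lambda>k. T (x k)) y"
    using weakly_converges_add_null[OF y a] by simp
  moreover have "range (\<lambda>k. T (x k)) \<subseteq> cball z (max r ((lam - 1) * r))"
    using T_in_cball x by blast
  ultimately show "y \<in> F"
    using assms(2) b unfolding weakly_regular_op_def by blast
qed

lemma infdist_Fix_U_le: "infdist x (Fix U) \<le> infdist (T x) (Fix U) + norm (T x - x)"
  using infdist_triangle[of x "Fix U" "T x"] by (simp add: dist_norm norm_minus_commute)

text \<open>Regularity of \<open>U\<close> controls the distance to \<open>Fix U\<close> from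
  \<open>T x\<close>; passing to \<open>x\<close> costs only the displacement of \<open>T\<close>,
  which also tends to zero.\<close>

lemma regular_comp:
  assumes "regular_op T (cball z r)" and "regular_op U (cball z (max r ((lam - 1) * r)))"
    and "regular_sets (Fix T) (Fix U) (cball z r)"
  shows "regular_op (U \<circ> T) (cball z r)"
  unfolding regular_op_def Fix_comp
proof (intro allI impI)
  fix x :: "nat \<Rightarrow> 'a"
  assume x: "range x \<subseteq> cball z r" and "(\<lambda>k. norm ((U \<circ> T) (x k) - x k)) \<longlonglongrightarrow> 0"
  then have a: "(\<lambda>k. norm (T (x k) - x k)) \<longlonglongrightarrow> 0"
    and b: "(\<lambda>k. norm (U (T (x k)) - T (x k))) \<longlonglongrightarrow> 0"
    using displacements_tendsto_0[OF x] by simp_all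
  have dT: "(\<lambda>k. infdist (x k) (Fix T)) \<longlonglongrightarrow> 0"
    using assms(1) x a unfolding regular_op_def by blast
  have "range (\<lambda>k. T (x k)) \<subseteq> cball z (max r ((lam - 1) * r))"
    using T_in_cball x by blast
  then have "(\<lambda>k. infdist (T (x k)) (Fix U)) \<longlonglongrightarrow> 0"
    using assms(2) b unfolding regular_op_def by blast
  from tendsto_add[OF this a]
  have "(\<lambda>k. infdist (T (x k)) (Fix U) + norm (T (x k) - x k)) \<longlonglongrightarrow> 0" by simp
  then have "(\<lambda>k. infdist (x k) (Fix U)) \<longlonglongrightarrow> 0"
    by (rule tendsto_sandwich[OF _ _ tendsto_const, rotated 2])
      (simp_all add: infdist_nonneg infdist_Fix_U_le)
  from tendsto_max[OF dT this]
  have "(\<lambda>k. max (infdist (x k) (Fix T)) (infdist (x k) (Fix U))) \<longlonglongrightarrow> 0" by simp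
  then show "(\<lambda>k. infdist (x k) F) \<longlonglongrightarrow> 0"
    using assms(3) x unfolding regular_sets_def by blast
qed

lemma linearly_regular_comp:
  assumes \<delta>1: "\<delta>1 \<in> {0<..1}" and \<delta>2: "\<delta>2 \<in> {0<..1}"
    and rT: "linearly_regular_op \<delta>1 T (cball z r)"
    and rU: "linearly_regular_op \<delta>2 U (cball z (max r ((lam - 1) * r)))"
    and rF: "linearly_regular_sets \<kappa> (Fix T) (Fix U) (cball z r)"
  shows "linearly_regular_op (((p + q) * min \<delta>1 \<delta>2 / (2 * \<kappa> * (1 + \<beta> * sqrt \<nu>)))\<^sup>2)
    (U \<circ> T) (cball z r)"
proof -
  define K where "K = 1 + \<beta> * sqrt \<nu>"
  define m where "m = min \<delta>1 \<delta>2"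
  define \<theta> where "\<theta> = (p + q) * m / (2 * \<kappa> * K)"
  have "0 < \<kappa>" using rF by (simp add: linearly_regular_sets_def)
  have K: "0 < K" using K_pos by (simp add: K_def)
  have m: "0 < m" "m \<le> 1" "m \<le> \<delta>1" "m \<le> \<delta>2" using \<delta>1 \<delta>2 by (auto simp: m_def)
  have \<theta>: "0 < \<theta>" using m K \<open>0 < \<kappa>\<close> pq_pos by (simp add: \<theta>_def)
  have "\<theta>\<^sup>2 * infdist x F \<le> norm (U (T x) - x)" if x: "x \<in> cball z r" for x
  proof -
    define d where "d = infdist x F"
    define a where "a = norm (T x - x)"
    define b where "b = norm (U (T x) - T x)"
    define w where "w = norm (U (T x) - x)"
    have nonneg: "0 \<le> d" "0 \<le> a" "0 \<le> b" "0 \<le> w"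
      by (simp_all add: d_def a_def b_def w_def infdist_nonneg)
    have "m * infdist x (Fix T) \<le> \<delta>1 * infdist x (Fix T)"
      using m by (simp add: mult_right_mono infdist_nonneg)
    also have "\<dots> \<le> a"
      using rT x by (simp add: linearly_regular_op_def a_def)
    finally have dT: "m * infdist x (Fix T) \<le> a + b" using nonneg by simp
    have "m * infdist (T x) (Fix U) \<le> \<delta>2 * infdist (T x) (Fix U)"
      using m by (simp add: mult_right_mono infdist_nonneg)
    also have "\<dots> \<le> b"
      using rU T_in_cball[OF x] by (simp add: linearly_regular_op_def b_def)
    finally have "m * infdist (T x) (Fix U) \<le> b" .
    moreover have "m * infdist x (Fix U) \<le> m * (infdist (T x) (Fix U) + a)"
      using m infdist_Fix_U_le by (simp add: a_def)
    \<comment> \<open>Here \<open>\<delta>1, \<delta>2 \<le> 1\<close> enters: the cost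
      \<open>a\<close> of passing from \<open>T x\<close> to \<open>x\<close> keeps coefficient at
      most one.\<close>
    moreover have "m * a \<le> a" using m nonneg by (simp add: mult_left_le_one_le)
    ultimately have dU: "m * infdist x (Fix U) \<le> a + b" by (simp add: distrib_left)
    have "d \<le> \<kappa> * max (infdist x (Fix T)) (infdist x (Fix U))"
      using rF x by (simp add: linearly_regular_sets_def d_def)
    then have "m * d \<le> \<kappa> * (m * max (infdist x (Fix T)) (infdist x (Fix U)))"
      using m by (simp add: mult.left_commute)
    also have "\<dots> \<le> \<kappa> * (a + b)"
      using dT dU \<open>0 < \<kappa>\<close> by (intro mult_left_mono) (auto simp: max_def)
    finally have "(p + q) * (m * d) \<le> (p + q) * (\<kappa> * (a + b))"
      using pq_pos by simp
    also have "\<dots> = \<kappa> * ((p + q) * a + (p + q) * b)" by (simp add: algebra_simps)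
    also have "\<dots> \<le> \<kappa> * (K * sqrt (d * w) + K * sqrt (d * w))"
      using displacement_bounds[of x] \<open>0 < \<kappa>\<close>
      by (intro mult_left_mono add_mono) (simp_all add: a_def b_def d_def w_def K_def)
    \<comment> \<open>The \<open>2\<close> in \<open>\<theta>\<close> comes from adding the two
      displacement bounds. Squaring and cancelling one factor \<open>d\<close> is what squares the
      final constant.\<close>
    finally have "\<theta> * d \<le> sqrt (d * w)"
      using \<open>0 < \<kappa>\<close> K by (simp add: \<theta>_def field_simps)
    then have "(\<theta> * d)\<^sup>2 \<le> (sqrt (d * w))\<^sup>2"
      using \<theta> nonneg by (intro power_mono) simp_all
    then have "d * (\<theta>\<^sup>2 * d) \<le> d * w"
      using nonneg by (simp add: power2_eq_square mult_ac)
    then have "\<theta>\<^sup>2 * d \<le> w"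
      using nonneg by (cases "d = 0") (auto simp: mult_le_cancel_left)
    then show ?thesis by (simp add: d_def w_def)
  qed
  with \<theta> have "linearly_regular_op (\<theta>\<^sup>2) (U \<circ> T) (cball z r)"
    unfolding linearly_regular_op_def Fix_comp by simp
  then show ?thesis by (simp only: \<theta>_def K_def m_def)
qed

end

section \<open>Computation of the coefficients and assembly of the three statements\<close>

theorem theorem3p2:
  fixes T U :: "'a::{real_inner, complete_space} \<Rightarrow> 'a"
    and z :: 'a and r R lam mu :: real
  assumes "0 < lam" and "0 < mu"
    and "relaxed_cutter lam T" and "relaxed_cutter mu U"
    and "lam * mu < 4"
    and "z \<in> Fix T \<inter> Fix U"
    and "0 < r"
    and "R = max r ((lam - 1) * r)"
  shows
    "(weakly_regular_op T (cball z r) \<and> weakly_regular_op U (cball z R)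
        \<longrightarrow> weakly_regular_op (U \<circ> T) (cball z r))
   \<and> (regular_op T (cball z r) \<and> regular_op U (cball z R)
        \<and> regular_sets (Fix T) (Fix U) (cball z r)
        \<longrightarrow> regular_op (U \<circ> T) (cball z r))
   \<and> (let \<nu> = 4 * (lam + mu - lam * mu) / (4 - lam * mu);
          \<alpha> = sqrt (1 / lam - 1 / \<nu>) - sqrt (1 / mu - 1 / \<nu>);
          \<beta> = max (sqrt (1 / lam - 1 / \<nu>)) (sqrt (1 / mu - 1 / \<nu>))
      in 0 < \<beta> \<and> (lam \<noteq> mu \<longrightarrow> \<alpha> \<noteq> 0) \<and>
         (\<forall>\<delta>1 \<in> {0<..1}. \<forall>\<delta>2 \<in> {0<..1}. \<forall>\<kappa>>0.
            linearly_regular_op \<delta>1 T (cball z r) \<and> linearly_regular_op \<delta>2 U (cball z R)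
            \<and> linearly_regular_sets \<kappa> (Fix T) (Fix U) (cball z r)
            \<longrightarrow> (\<alpha> \<noteq> 0 \<longrightarrow>
                  linearly_regular_op
                    ((\<bar>\<alpha>\<bar> * min \<delta>1 \<delta>2 / (2 * \<kappa> * (1 + \<beta> * sqrt \<nu>)))\<^sup>2) (U \<circ> T) (cball z r))
              \<and> (\<alpha> = 0 \<longrightarrow> (\<exists>\<delta>. linearly_regular_op \<delta> (U \<circ> T) (cball z r)))))"
proof -
  define D where "D = lam + mu - lam * mu"
  define s where "s = 2 * sqrt (lam * mu * D)"
  \<comment> \<open>The factors \<open>2 - lam\<close> and \<open>2 - mu\<close> carry the signs;
    with them \<open>p + q = 2 * D / s\<close>, which stays positive even if one parameter exceeds
    2.\<close>
  define p where "p = mu * (2 - lam) / s"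
  define q where "q = lam * (2 - mu) / s"
  \<comment> \<open>For this value the quadratic form in \<open>a\<close>, \<open>b\<close> minus
    \<open>(norm (a + b))\<^sup>2 / \<nu>\<close> has zero discriminant, hence is a perfect
    square.\<close>
  define \<nu> where "\<nu> = 4 * (lam + mu - lam * mu) / (4 - lam * mu)"
  have "0 < lam * mu" using assms(1,2) by simp
  \<comment> \<open>Positivity of \<open>D\<close> follows from \<open>lam * mu < 4\<close> and the
    arithmetic-geometric mean inequality.\<close>
  have "(lam * mu)\<^sup>2 < 4 * (lam * mu)"
    using \<open>0 < lam * mu\<close> assms(5) unfolding power2_eq_square by (intro mult_strict_right_mono)
  also have "\<dots> \<le> (lam + mu)\<^sup>2"
    using zero_le_power2[of "lam - mu"] by (simp add: power2_eq_square algebra_simps)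
  finally have "lam * mu < lam + mu"
    by (rule power2_less_imp_less) (use assms(1,2) in auto)
  then have "0 < D" by (simp add: D_def)
  have \<nu>: "\<nu> = 4 * D / (4 - lam * mu)" by (simp add: \<nu>_def D_def)
  then have \<nu>_pos: "0 < \<nu>" and inv_\<nu>: "1 / \<nu> = (4 - lam * mu) / (4 * D)"
    using \<open>0 < D\<close> assms(5) by simp_all
  have s: "0 < s" and s_sq: "s\<^sup>2 = 4 * (lam * mu * D)"
    using \<open>0 < D\<close> assms(1,2) by (simp_all add: s_def power_mult_distrib)
  have "p\<^sup>2 = mu\<^sup>2 * (2 - lam)\<^sup>2 / (4 * (lam * mu * D))"
    by (simp add: p_def power_divide power_mult_distrib s_sq)
  \<comment> \<open>The numerator equals \<open>mu * (2 - lam)\<^sup>2\<close>; the case of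
    \<open>q\<close> below is symmetric.\<close>
  also have "\<dots> = (4 * D - lam * (4 - lam * mu)) / (4 * lam * D)"
    using assms(1,2) \<open>0 < D\<close> by (simp add: D_def divide_simps) (simp add: power2_eq_square algebra_simps)
  also have "\<dots> = 1 / lam - 1 / \<nu>"
    unfolding inv_\<nu> using assms(1) \<open>0 < D\<close> by (simp add: field_simps)
  finally have p_sq: "p\<^sup>2 = 1 / lam - 1 / \<nu>" .
  have "q\<^sup>2 = lam\<^sup>2 * (2 - mu)\<^sup>2 / (4 * (lam * mu * D))"
    by (simp add: q_def power_divide power_mult_distrib s_sq)
  also have "\<dots> = (4 * D - mu * (4 - lam * mu)) / (4 * mu * D)"
    using assms(1,2) \<open>0 < D\<close> by (simp add: D_def divide_simps) (simp add: power2_eq_square algebra_simps)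
  also have "\<dots> = 1 / mu - 1 / \<nu>"
    unfolding inv_\<nu> using assms(2) \<open>0 < D\<close> by (simp add: field_simps)
  finally have q_sq: "q\<^sup>2 = 1 / mu - 1 / \<nu>" .
  have "2 * p * q = 2 * (lam * mu * ((2 - lam) * (2 - mu))) / s\<^sup>2"
    by (simp add: p_def q_def power2_eq_square)
  also have "\<dots> = (2 - lam) * (2 - mu) / (2 * D)"
    unfolding s_sq using assms(1,2) by simp
  also have "\<dots> = (4 - lam * mu - 2 * D) / (2 * D)" by (simp add: D_def algebra_simps)
  also have "\<dots> = 2 * (1 / \<nu>) - 1"
    unfolding inv_\<nu> using \<open>0 < D\<close> by (simp add: field_simps)
  finally have pq: "2 * p * q = 2 / \<nu> - 1" by simp
  have "p + q = 2 * D / s"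
    by (simp add: p_def q_def D_def add_divide_distrib[symmetric] algebra_simps)
  then have pq_pos: "0 < p + q" using \<open>0 < D\<close> s by simp
  interpret relaxed_cutter_pair T U lam mu \<nu> p q z r
    using assms(3,4,6,7) \<nu>_pos p_sq q_sq pq pq_pos by unfold_locales
  define \<alpha> where "\<alpha> = \<bar>p\<bar> - \<bar>q\<bar>"
  have sqrt_p: "sqrt (1 / lam - 1 / \<nu>) = \<bar>p\<bar>" and sqrt_q: "sqrt (1 / mu - 1 / \<nu>) = \<bar>q\<bar>"
    by (simp_all flip: p_sq q_sq)
  have \<beta>_pos: "0 < \<beta>" using pq_pos by (auto simp: \<beta>_def)
  have \<alpha>_ne: "\<alpha> \<noteq> 0" if "lam \<noteq> mu"
  proof
    assume "\<alpha> = 0"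
    \<comment> \<open>Equal moduli leave \<open>p = q\<close> or \<open>p = - q\<close>, and the
      latter contradicts \<open>0 < p + q\<close>.\<close>
    with pq_pos have "p = q" by (simp add: \<alpha>_def abs_if split: if_splits)
    with s have "mu * (2 - lam) = lam * (2 - mu)" by (simp add: p_def q_def)
    with that show False by (simp add: algebra_simps)
  qed
  have \<alpha>_le: "\<bar>\<alpha>\<bar> \<le> p + q" using pq_pos by (simp add: \<alpha>_def)
  have sharp: "linearly_regular_op ((\<bar>\<alpha>\<bar> * min \<delta>1 \<delta>2 / (2 * \<kappa> * (1 + \<beta> * sqrt \<nu>)))\<^sup>2)
      (U \<circ> T) (cball z r)"
    if "\<alpha> \<noteq> 0" "\<delta>1 \<in> {0<..1}" "\<delta>2 \<in> {0<..1}" "0 < \<kappa>"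
      and reg: "linearly_regular_op (((p + q) * min \<delta>1 \<delta>2 / (2 * \<kappa> * (1 + \<beta> * sqrt \<nu>)))\<^sup>2)
        (U \<circ> T) (cball z r)" for \<delta>1 \<delta>2 \<kappa>
  proof (rule linearly_regular_op_mono[OF reg])
    show "0 < (\<bar>\<alpha>\<bar> * min \<delta>1 \<delta>2 / (2 * \<kappa> * (1 + \<beta> * sqrt \<nu>)))\<^sup>2"
      using that K_pos by (intro zero_less_power divide_pos_pos mult_pos_pos) auto
    show "(\<bar>\<alpha>\<bar> * min \<delta>1 \<delta>2 / (2 * \<kappa> * (1 + \<beta> * sqrt \<nu>)))\<^sup>2
        \<le> ((p + q) * min \<delta>1 \<delta>2 / (2 * \<kappa> * (1 + \<beta> * sqrt \<nu>)))\<^sup>2"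
      using that K_pos \<alpha>_le
      by (intro power_mono divide_right_mono mult_right_mono divide_nonneg_nonneg mult_nonneg_nonneg)
        auto
  qed
  show ?thesis
    unfolding Let_def \<nu>_def[symmetric] sqrt_p sqrt_q assms(8)
      \<alpha>_def[symmetric] \<beta>_def[symmetric]
    \<comment> \<open>For \<open>\<alpha> = 0\<close> the constant with \<open>p + q\<close> from
      \<open>linearly_regular_comp\<close> is the witness.\<close>
    using weakly_regular_comp regular_comp \<beta>_pos \<alpha>_ne
      sharp[OF _ _ _ _ linearly_regular_comp] linearly_regular_comp
    by blast
qed

end
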